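(* Let $P$ be a finite poset with $|P|\ge 2$, let $\mathcal{F}$ be a family of posets, let $k$ be a positive integer, and let $n=|P|^k=|P^k|$. Then \[ \operatorname{ex}^{*}(|P|^k,\mathcal{F})\;\le\;\operatorname{ex}^{*}(P^k,\mathcal{F})\;\le\; n^{\log_{|P|}(\operatorname{ex}^{*}(P,\mathcal{F}))}, \] where the right-hand side is to be read as $\left(\operatorname{ex}^{*}(P,\mathcal{F})\right)^k$ (which equals $n^{\log_{|P|}(\operatorname{ex}^{*}(P,\mathcal{F}))}$ whenever $\operatorname{ex}^{*}(P,\mathcal{F})\ge 1$).
   Context: For a poset $Q$ and a family of posets $\mathcal{F}$, a subposet of $Q$ is $\mathcal{F}$-free if it contains no member of $\mathcal{F}$ as an induced subposet. $\operatorname{ex}^{*}(Q,\mathcal{F})$ denotes the maximum size of an induced subposet of $Q$ that is $\mathcal{F}$-free. For a positive integer $n$, $\operatorname{ex}^{*}(n,\mathcal{F})$ denotes the minimum of $\operatorname{ex}^{*}(Q,\mathcal{F})$ over all $n$-element posets $Q$. For a poset $P$ and positive integer $k$, $P^k$ denotes the set of $k$-tuples of elements of $P$ with the lexicographic order: $(a_1,\dots,a_k)<(b_1,\dots,b_k)$ iff at the first index $i$ with $a_i\ne b_i$ one has $a_i<b_i$ in $P$. *)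

theory Defs
  imports Complex_Main
begin

text \<open>
  A poset is given by its reflexive order relation \<open>Q\<close> with \<open>Partial_order Q\<close>; its ground set is
  \<open>Field Q\<close>, and the subposet induced on \<open>S \<subseteq> Field Q\<close> is \<open>Restr Q S\<close>.  The library predicate
  \<open>iso\<close> is order isomorphism for arbitrary relations (see \<open>iso_iff2\<close>), although it is defined
  in the context of well-orders.
\<close>

definition free_poset :: "'a rel \<Rightarrow> 'b rel set \<Rightarrow> bool" where
  "free_poset Q F \<longleftrightarrow> \<not> (\<exists>p\<in>F. \<exists>S\<subseteq>Field Q. \<exists>f. iso p (Restr Q S) f)"

text \<open>
  For finite \<open>Q\<close> the supremum below is a maximum, except when \<open>F\<close> contains the empty poset: then
  no subposet is \<open>F\<close>-free and the value is \<open>Sup {} = 0\<close>.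
\<close>

definition ex_poset :: "'a rel \<Rightarrow> 'b rel set \<Rightarrow> nat" where
  "ex_poset Q F = Sup {card S |S. S \<subseteq> Field Q \<and> free_poset (Restr Q S) F}"

text \<open>
  Every \<open>n\<close>-element poset has an isomorphic copy with ground set in \<open>nat\<close>, and \<open>ex_poset\<close> is
  invariant under isomorphism.  The set of values is nonempty, so \<open>Inf\<close> is a minimum.
\<close>

definition ex_size :: "nat \<Rightarrow> 'b rel set \<Rightarrow> nat" where
  "ex_size n F =
     Inf {ex_poset Q F |Q :: nat rel. Partial_order Q \<and> finite (Field Q) \<and> card (Field Q) = n}"

text \<open>\<open>k\<close>-tuples are lists of length \<open>k\<close>; \<open>P - Id\<close> is the strict order of \<open>P\<close>.\<close>

definition lex_power :: "'a rel \<Rightarrow> nat \<Rightarrow> 'a list rel" where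
  "lex_power P k = Restr ((lexn (P - Id) k)\<^sup>=) {xs. length xs = k \<and> set xs \<subseteq> Field P}"

lemma lex_power_iff:
  "(xs, ys) \<in> lex_power P k \<longleftrightarrow>
     length xs = k \<and> set xs \<subseteq> Field P \<and> length ys = k \<and> set ys \<subseteq> Field P \<and>
     (xs = ys \<or> (\<exists>i<k. take i xs = take i ys \<and> xs ! i \<noteq> ys ! i \<and> (xs ! i, ys ! i) \<in> P))"
proof -
  have "(xs, ys) \<in> lexn (P - Id) k \<longleftrightarrow>
      (\<exists>i<k. take i xs = take i ys \<and> xs ! i \<noteq> ys ! i \<and> (xs ! i, ys ! i) \<in> P)" (is "?L \<longleftrightarrow> ?R")
    if len: "length xs = k" "length ys = k"
  proof
    assume ?L
    then obtain us x y xs' ys' where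
      "xs = us @ x # xs'" "ys = us @ y # ys'" "(x, y) \<in> P - Id"
      unfolding lexn_conv by blast
    with len show ?R by (intro exI[of _ "length us"]) auto
  next
    assume ?R
    then obtain i where i: "i < k" "take i xs = take i ys" "(xs ! i, ys ! i) \<in> P - Id" by auto
    have "xs = take i xs @ xs ! i # drop (Suc i) xs" "ys = take i xs @ ys ! i # drop (Suc i) ys"
      using i len id_take_nth_drop[of i xs] id_take_nth_drop[of i ys] by simp_all
    with i len show ?L unfolding lexn_conv by blast
  qed
  then show ?thesis unfolding lex_power_def by auto
qed

lemma Field_lex_power: "Field (lex_power P k) = {xs. length xs = k \<and> set xs \<subseteq> Field P}"
  unfolding Field_def Domain_unfold Range_def lex_power_iff by (auto simp: Field_def lex_power_iff)

lemma Partial_order_lex_power: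
  assumes "Partial_order P"
  shows "Partial_order (lex_power P k)"
proof -
  have P: "trans P" "antisym P"
    using assms by (auto simp: partial_order_on_def preorder_on_def)
  have tr: "trans (P - Id)" using P by (rule trans_diff_Id)
  have "trans (lexn (P - Id) k)" using lexn_transI[OF tr] .
  moreover have "irrefl (lexn (P - Id) k)"
    by (auto simp: irrefl_def lexn_conv)
  ultimately have "trans (lex_power P k)" "antisym (lex_power P k)"
    by (auto simp: lex_power_def trans_def antisym_def irrefl_def)
  moreover have "refl_on (Field (lex_power P k)) (lex_power P k)"
    unfolding Field_lex_power refl_on_def by (simp add: lex_power_iff)
  moreover have "lex_power P k \<subseteq> Field (lex_power P k) \<times> Field (lex_power P k)"
    by (auto simp: Field_def)
  ultimately show ?thesis
    unfolding partial_order_on_def preorder_on_def by simp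
qed

lemma ex_poset_attained:
  assumes "finite (Field Q)" and "\<And>p. p \<in> F \<Longrightarrow> p \<noteq> {}"
  obtains S where "S \<subseteq> Field Q" "free_poset (Restr Q S) F" "card S = ex_poset Q F"
    "\<And>T. T \<subseteq> Field Q \<Longrightarrow> free_poset (Restr Q T) F \<Longrightarrow> card T \<le> card S"
proof -
  let ?X = "{card S |S. S \<subseteq> Field Q \<and> free_poset (Restr Q S) F}"
  have fin: "finite ?X" using assms(1) by simp
  have "free_poset (Restr Q {}) F"
    using assms(2) by (fastforce simp: free_poset_def iso_iff2 bij_betw_def Field_def)
  then have ne: "?X \<noteq> {}" by blast
  then have eq: "ex_poset Q F = Max ?X" unfolding ex_poset_def Sup_nat_def by (simp only: if_False)
  with Max_in[OF fin ne] obtain S where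
    "S \<subseteq> Field Q" "free_poset (Restr Q S) F" "card S = ex_poset Q F" by auto
  moreover have "card T \<le> ex_poset Q F" if "T \<subseteq> Field Q" "free_poset (Restr Q T) F" for T
    unfolding eq using fin that by (intro Max_ge) auto
  ultimately show ?thesis using that by simp
qed

end

theory Submission
  imports Defs
begin

text \<open>
  Fix an \<open>F\<close>-free \<open>S\<close> in the lexicographic power with exponent \<open>k + 1\<close>. One representative in \<open>S\<close>
  for each first coordinate gives a copy inside \<open>S\<close> of the set of first coordinates of \<open>S\<close>, and
  the tuples of \<open>S\<close> with a given first coordinate are a copy of a subposet of the power with
  exponent \<open>k\<close>. Both inherit \<open>F\<close>-freeness, so \<open>card S\<close> is at most the product of the two bounds.
\<close>

text \<open>Freeness passes from the target of an order embedding to its source: a copy of some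
  \<open>p\<close> in \<open>Restr P A\<close>, given by \<open>f\<close>, would be carried by
  \<open>g\<close> to a copy in \<open>Restr Q T\<close>, given by
  \<open>g \<circ> f\<close>.\<close>

lemma free_poset_embed:
  assumes free: "free_poset (Restr Q T) F"
    and inj: "inj_on g A" and img: "g ` A \<subseteq> T"
    and ord: "\<And>x y. x \<in> A \<Longrightarrow> y \<in> A \<Longrightarrow> (x, y) \<in> P \<longleftrightarrow> (g x, g y) \<in> Q"
  shows "free_poset (Restr P A) F"
  unfolding free_poset_def
proof (rule notI, elim bexE exE conjE)
  fix p S f
  assume p: "p \<in> F" and S: "S \<subseteq> Field (Restr P A)" and iso: "iso p (Restr (Restr P A) S) f"
  have SA: "S \<subseteq> A" using S by (auto simp: Field_def)
  have "g ` Field (Restr P A) \<subseteq> Field (Restr Q T)"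
    using img ord by (fastforce simp: Field_def)
  with S have S': "g ` S \<subseteq> Field (Restr Q T)" by blast
  have mem: "(g x, g y) \<in> Restr (Restr Q T) (g ` S) \<longleftrightarrow> (x, y) \<in> Restr (Restr P A) S"
    if "x \<in> A" "y \<in> A" for x y
    using that img ord inj SA by (auto simp: inj_on_image_mem_iff)
  \<comment> \<open>Once the transported relation is an image under \<open>map_prod g g\<close>, its
    field follows by taking projections.\<close>
  have "Restr (Restr Q T) (g ` S) = map_prod g g ` Restr (Restr P A) S"
  proof (intro set_eqI iffI)
    fix z assume z: "z \<in> Restr (Restr Q T) (g ` S)"
    then obtain x y where xy: "z = (g x, g y)" "x \<in> S" "y \<in> S" by auto
    with SA have "x \<in> A" "y \<in> A" by auto
    from z[unfolded xy(1) mem[OF this]] show "z \<in> map_prod g g ` Restr (Restr P A) S"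
      unfolding xy(1) by (rule map_prod_imageI)
  next
    fix z assume "z \<in> map_prod g g ` Restr (Restr P A) S"
    then obtain x y where xy: "z = (g x, g y)" "(x, y) \<in> Restr (Restr P A) S"
      by (elim imageE) (metis map_prod_simp surj_pair)
    then have "x \<in> A" "y \<in> A" by auto
    from xy(2)[folded mem[OF this]] show "z \<in> Restr (Restr Q T) (g ` S)"
      unfolding xy(1) .
  qed
  then have fld: "Field (Restr (Restr Q T) (g ` S)) = g ` Field (Restr (Restr P A) S)"
    by (simp only: Field_def Domain_fst Range_snd image_Un image_image fst_map_prod snd_map_prod)
  have bij: "bij_betw f (Field p) (Field (Restr (Restr P A) S))"
    and f: "\<And>a b. a \<in> Field p \<Longrightarrow> b \<in> Field p \<Longrightarrow>
        (a, b) \<in> p \<longleftrightarrow> (f a, f b) \<in> Restr (Restr P A) S"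
    using iso unfolding iso_iff2 by auto
  have sub: "Field (Restr (Restr P A) S) \<subseteq> A" by (auto simp: Field_def)
  have fA: "f a \<in> A" if "a \<in> Field p" for a
    using bij_betwE[OF bij] sub that by blast
  have "bij_betw g (Field (Restr (Restr P A) S)) (Field (Restr (Restr Q T) (g ` S)))"
    unfolding fld using inj_on_subset[OF inj sub] by (rule inj_on_imp_bij_betw)
  with bij have "bij_betw (g \<circ> f) (Field p) (Field (Restr (Restr Q T) (g ` S)))"
    by (rule bij_betw_trans)
  moreover have "(a, b) \<in> p \<longleftrightarrow> ((g \<circ> f) a, (g \<circ> f) b) \<in> Restr (Restr Q T) (g ` S)"
    if "a \<in> Field p" "b \<in> Field p" for a b
    unfolding o_apply f[OF that] by (rule mem[OF fA fA, symmetric]) fact+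
  ultimately have "iso p (Restr (Restr Q T) (g ` S)) (g \<circ> f)"
    unfolding iso_iff2 by blast
  with p S' free show False unfolding free_poset_def by blast
qed

lemma card_le_ex_poset:
  assumes "finite (Field Q)" "S \<subseteq> Field Q" "free_poset (Restr Q S) F"
  shows "card S \<le> ex_poset Q F"
  unfolding ex_poset_def
proof (rule cSup_upper)
  show "card S \<in> {card S |S. S \<subseteq> Field Q \<and> free_poset (Restr Q S) F}" using assms by blast
  have "finite {card S |S. S \<subseteq> Field Q \<and> free_poset (Restr Q S) F}" using assms(1) by simp
  then show "bdd_above {card S |S. S \<subseteq> Field Q \<and> free_poset (Restr Q S) F}" by simp
qed

lemma ex_poset_le:
  assumes "\<And>S. S \<subseteq> Field Q \<Longrightarrow> free_poset (Restr Q S) F \<Longrightarrow> card S \<le> m"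
  shows "ex_poset Q F \<le> m"
proof (cases "{card S |S. S \<subseteq> Field Q \<and> free_poset (Restr Q S) F} = {}")
  \<comment> \<open>No subposet is free, not even the empty one, so \<open>F\<close> contains the
    empty poset and the supremum takes its default value 0.\<close>
  case True
  then show ?thesis unfolding ex_poset_def by (simp only: Sup_nat_empty)
next
  case False
  then show ?thesis unfolding ex_poset_def by (rule cSup_least) (use assms in blast)
qed

text \<open>A free \<open>S\<close> and its image under \<open>g\<close> have equal size, and the
  inverse of \<open>g\<close> embeds the image back into \<open>S\<close>, so the image is free as
  well.\<close>

lemma ex_poset_embed_le:
  assumes fin: "finite (Field Q)" and inj: "inj_on g (Field P)" and img: "g ` Field P \<subseteq> Field Q"
    and ord: "\<And>x y. x \<in> Field P \<Longrightarrow> y \<in> Field P \<Longrightarrow> (x, y) \<in> P \<longleftrightarrow> (g x, g y) \<in> Q"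
  shows "ex_poset P F \<le> ex_poset Q F"
proof (rule ex_poset_le)
  fix S assume S: "S \<subseteq> Field P" and free: "free_poset (Restr P S) F"
  have injS: "inj_on g S" using inj S by (rule inj_on_subset)
  have "free_poset (Restr Q (g ` S)) F"
  proof (rule free_poset_embed[OF free])
    show "inj_on (inv_into S g) (g ` S)" by (rule inj_on_inv_into) simp
    show "inv_into S g ` g ` S \<subseteq> S" using injS by auto
    show "(x, y) \<in> Q \<longleftrightarrow> (inv_into S g x, inv_into S g y) \<in> P"
      if "x \<in> g ` S" "y \<in> g ` S" for x y
      using that injS ord[OF subsetD[OF S] subsetD[OF S]] by auto
  qed
  moreover have "g ` S \<subseteq> Field Q" using img S by blast
  ultimately have "card (g ` S) \<le> ex_poset Q F" using fin by (intro card_le_ex_poset)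
  then show "card S \<le> ex_poset Q F" by (simp add: card_image[OF injS])
qed

text \<open>The minimum in \<open>ex_size\<close> ranges over relations on \<open>nat\<close>,
  whereas \<open>R\<close> may live on any type; an isomorphic copy of \<open>R\<close> on an
  initial segment of \<open>nat\<close> bridges the gap.\<close>

lemma ex_size_le:
  assumes po: "Partial_order R" and fin: "finite (Field R)"
  shows "ex_size (card (Field R)) F \<le> ex_poset R F"
proof -
  obtain g where g: "bij_betw g {0..<card (Field R)} (Field R)"
    using ex_bij_betw_nat_finite[OF fin] by blast
  define N where "N = {0..<card (Field R)}"
  \<comment> \<open>The order of \<open>R\<close> is pulled back along the enumeration
    \<open>g\<close>. Restricting to \<open>N\<close> keeps out arguments where \<open>g\<close> is
    unspecified, and injectivity on \<open>N\<close> yields antisymmetry.\<close>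
  define Q where "Q = Restr (inv_image R g) N"
  have inj: "inj_on g N" and img: "g ` N = Field R" using g by (auto simp: bij_betw_def N_def)
  have R: "refl_on (Field R) R" "trans R" "antisym R"
    using po by (auto simp: partial_order_on_def preorder_on_def)
  have refl: "(x, x) \<in> Q" if "x \<in> N" for x
    using that R(1) img by (auto simp: Q_def refl_on_def)
  have fld: "Field Q = N"
    using FieldI1[OF refl] by (auto simp: Q_def Field_def)
  have "trans Q" using R(2) by (auto simp: Q_def trans_def)
  moreover have "antisym Q" using R(3) inj by (auto simp: Q_def antisym_def inj_on_def)
  moreover have "refl_on N Q" using refl by (simp add: refl_on_def)
  moreover have "Q \<subseteq> N \<times> N" by (auto simp: Q_def)
  ultimately have "Partial_order Q" by (simp add: partial_order_on_def preorder_on_def fld)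
  then have "ex_size (card (Field R)) F \<le> ex_poset Q F"
    unfolding ex_size_def by (intro cInf_lower) (auto simp: fld N_def)
  also have "\<dots> \<le> ex_poset R F"
    by (rule ex_poset_embed_le[where g = g]) (use fin inj img fld in \<open>auto simp: Q_def\<close>)
  finally show ?thesis .
qed

text \<open>The recursive form of the order that drives the induction: equal heads leave the
  decision to the tails, which embeds fibres, and distinct heads decide alone, which embeds the set
  of heads.\<close>

lemma Cons_lex_power_Suc_iff:
  "(a # xs, b # ys) \<in> lex_power P (Suc k) \<longleftrightarrow>
     a \<in> Field P \<and> b \<in> Field P \<and> xs \<in> Field (lex_power P k) \<and> ys \<in> Field (lex_power P k) \<and>
     (if a = b then (xs, ys) \<in> lex_power P k else (a, b) \<in> P)"
  unfolding lex_power_iff Field_lex_power Ex_less_Suc2 by auto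

lemma finite_Field_lex_power:
  assumes "finite (Field P)"
  shows "finite (Field (lex_power P k))"
  using finite_lists_length_eq[OF assms, of k] by (simp add: Field_lex_power conj_commute)

lemma card_Field_lex_power:
  assumes "finite (Field P)"
  shows "card (Field (lex_power P k)) = card (Field P) ^ k"
  using card_lists_length_eq[OF assms, of k] by (simp add: Field_lex_power conj_commute)

lemma free_subset_lex_power_card_le:
  assumes refl: "refl_on (Field P) P" and fin: "finite (Field P)"
    and "S \<subseteq> Field (lex_power P k)" and "free_poset (Restr (lex_power P k) S) F"
  shows "card S \<le> ex_poset P F ^ k"
  using assms(3,4)
proof (induction k arbitrary: S)
  case 0
  \<comment> \<open>The bound to reach is 1, also when \<open>ex_poset P F\<close> is 0.\<close>
  then have "S \<subseteq> {[]}" by (auto simp: Field_lex_power)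
  then show ?case using card_mono[of "{[]}" S] by simp
next
  case (Suc k)
  define A where "A = hd ` S"
  \<comment> \<open>The fibre of \<open>S\<close> over the head \<open>a\<close>, with that head
    removed so that it lies in the power with exponent \<open>k\<close>.\<close>
  define B where "B a = {xs. a # xs \<in> S}" for a
  have S_Cons: "hd xs # tl xs = xs" "hd xs \<in> Field P" "tl xs \<in> Field (lex_power P k)"
    if "xs \<in> S" for xs
    using Suc.prems(1) that by (cases xs; force simp: Field_lex_power)+
  have B_sub: "B a \<subseteq> Field (lex_power P k)" for a
    using S_Cons(3) by (force simp: B_def)
  have A_sub: "A \<subseteq> Field P" using S_Cons(2) by (auto simp: A_def)
  have card_B: "card (B a) \<le> ex_poset P F ^ k" if "a \<in> A" for a
  proof (rule Suc.IH[OF B_sub])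
    show "free_poset (Restr (lex_power P k) (B a)) F"
      by (rule free_poset_embed[OF Suc.prems(2), where g = "(#) a"])
        (use that A_sub B_sub in \<open>auto simp: B_def Cons_lex_power_Suc_iff\<close>)
  qed
  \<comment> \<open>A choice of one tuple of \<open>S\<close> for each head.\<close>
  define r where "r = inv_into S hd"
  have r: "r a \<in> S" "hd (r a) = a" if "a \<in> A" for a
    using that by (auto simp: A_def r_def inv_into_into f_inv_into_f)
  have "free_poset (Restr P A) F"
  proof (rule free_poset_embed[OF Suc.prems(2), where g = r])
    show "inj_on r A" by (metis inj_onI r(2))
    show "r ` A \<subseteq> S" using r(1) by blast
    \<comment> \<open>For distinct heads the chosen tails have no influence on the order; for equal
      heads the representatives coincide and both sides hold by reflexivity.\<close>
    fix a b assume ab: "a \<in> A" "b \<in> A"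
    have "r a = a # tl (r a)" "r b = b # tl (r b)"
      using S_Cons(1) r ab by metis+
    moreover have "tl (r a) \<in> Field (lex_power P k)" "tl (r b) \<in> Field (lex_power P k)"
      using S_Cons(3) r(1) ab by blast+
    moreover have "(xs, xs) \<in> lex_power P k" if "xs \<in> Field (lex_power P k)" for xs
      using that by (simp add: lex_power_iff Field_lex_power)
    moreover have "(a, a) \<in> P" using refl ab A_sub by (auto simp: refl_on_def)
    moreover have "a \<in> Field P" "b \<in> Field P" using ab A_sub by auto
    ultimately show "(a, b) \<in> P \<longleftrightarrow> (r a, r b) \<in> lex_power P (Suc k)"
      using Cons_lex_power_Suc_iff[of a "tl (r a)" b "tl (r b)" P k] by (cases "a = b") auto
  qed
  then have card_A: "card A \<le> ex_poset P F" using fin A_sub by (intro card_le_ex_poset)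
  have finA: "finite A" using A_sub fin by (rule finite_subset)
  have finB: "finite (B a)" for a
    using B_sub finite_Field_lex_power[OF fin] by (rule finite_subset)
  \<comment> \<open>Splitting off heads covers \<open>S\<close> by its fibres, so its size is at
    most the sum of theirs.\<close>
  have "S \<subseteq> (\<lambda>(a, xs). a # xs) ` (SIGMA a:A. B a)"
  proof
    fix xs assume xs: "xs \<in> S"
    then have "(hd xs, tl xs) \<in> (SIGMA a:A. B a)" using S_Cons(1) by (simp add: A_def B_def)
    then show "xs \<in> (\<lambda>(a, xs). a # xs) ` (SIGMA a:A. B a)"
      using S_Cons(1)[OF xs] by (metis (no_types, lifting) case_prod_conv image_eqI)
  qed
  then have "card S \<le> card (SIGMA a:A. B a)"
    using finA finB by (intro surj_card_le) auto
  also have "\<dots> = (\<Sum>a\<in>A. card (B a))" using finA finB by (intro card_SigmaI) auto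
  also have "\<dots> \<le> card A * ex_poset P F ^ k"
    using sum_bounded_above[of A "\<lambda>a. card (B a)" "ex_poset P F ^ k"] card_B by simp
  also have "\<dots> \<le> ex_poset P F ^ Suc k" using card_A by simp
  finally show ?case .
qed

text \<open>Exponents commute, so the right side is the power with exponent \<open>k\<close> of
  \<open>b powr log b x\<close>, which is \<open>x\<close>.\<close>

lemma power_eq_power_powr_log:
  fixes b x :: real
  assumes "b > 1" "x > 0"
  shows "x ^ k = (b ^ k) powr log b x"
proof -
  have "(b ^ k) powr log b x = (b powr log b x) powr real k"
    using assms(1) by (simp add: powr_powr mult.commute flip: powr_realpow)
  also have "\<dots> = x ^ k" using assms by (simp add: powr_realpow)
  finally show ?thesis by simp
qed

theorem theorem1:
  fixes P :: "'a rel" and F :: "'b rel set" and k n :: nat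
  assumes "Partial_order P" and "finite (Field P)" and "card (Field P) \<ge> 2"
    and "\<And>p. p \<in> F \<Longrightarrow> Partial_order p"
    and "k > 0"
    and "n = card (Field P) ^ k"
  shows "n = card (Field (lex_power P k)) \<and>
    ex_size n F \<le> ex_poset (lex_power P k) F \<and>
    ex_poset (lex_power P k) F \<le> ex_poset P F ^ k \<and>
    (ex_poset P F \<ge> 1 \<longrightarrow>
      real (ex_poset P F ^ k) = real n powr log (real (card (Field P))) (real (ex_poset P F)))"
proof (intro conjI impI)
  show n: "n = card (Field (lex_power P k))"
    using assms(2,6) by (simp add: card_Field_lex_power)
  show "ex_size n F \<le> ex_poset (lex_power P k) F"
    unfolding n using assms(1,2)
    by (intro ex_size_le Partial_order_lex_power finite_Field_lex_power)
  have "refl_on (Field P) P"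
    using assms(1) by (simp add: partial_order_on_def preorder_on_def)
  then show "ex_poset (lex_power P k) F \<le> ex_poset P F ^ k"
    using assms(2) by (intro ex_poset_le free_subset_lex_power_card_le)
  \<comment> \<open>At least two elements in \<open>P\<close> make the base of the logarithm exceed
    1, and \<open>ex_poset P F \<ge> 1\<close> makes its argument positive.\<close>
  show "real (ex_poset P F ^ k) = real n powr log (real (card (Field P))) (real (ex_poset P F))"
    if "ex_poset P F \<ge> 1"
    using power_eq_power_powr_log[of "real (card (Field P))" "real (ex_poset P F)" k] that assms(3,6)
    by simp
qed

end
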